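(* Let $X_1,X_2,\ldots$ be i.i.d. real random variables with continuous distribution and let $\theta>0$. For $\vartheta\in\{\theta,1/\theta\}$ set $p_0(\vartheta):=1$ and, for $n\ge1$, $p_n(\vartheta):=\mathbb P(X_2\ge\vartheta X_1,\ldots,X_{n+1}\ge\vartheta X_n)$. Then $$p_n(\theta)=\sum_{k=1}^n p_{n-k}(\theta)\,p_{k-1}(1/\theta)\,(-1)^{k-1}+(-1)^n p_n(1/\theta),\qquad n\ge0.$$ Furthermore, denoting $\hat P_\vartheta(z):=\sum_{n=0}^\infty p_n(\vartheta)z^n$, we have, as formal power series in $z$, $$\hat P_\theta(z)=\frac{\hat P_{1/\theta}(-z)}{1-z\,\hat P_{1/\theta}(-z)}.$$
   Context: "Continuous distribution" means that the distribution function is continuous, i.e. the common law of the $X_i$ has no atoms. *)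

theory Defs
  imports "HOL-Probability.Probability" "HOL-Computational_Algebra.Formal_Power_Series"
begin

(* The sequence is X 1, X 2, ...; the value X 0 is never used. *)
definition p :: "'a measure \<Rightarrow> (nat \<Rightarrow> 'a \<Rightarrow> real) \<Rightarrow> real \<Rightarrow> nat \<Rightarrow> real" where
  "p M X t n =
     (if n = 0 then 1
      else measure M {\<omega> \<in> space M. \<forall>k\<in>{1..n}. X (k + 1) \<omega> \<ge> t * X k \<omega>})"

definition P_hat :: "'a measure \<Rightarrow> (nat \<Rightarrow> 'a \<Rightarrow> real) \<Rightarrow> real \<Rightarrow> real fps" where
  "P_hat M X t = Abs_fps (p M X t)"

end

theory Submission
  imports Defs
begin

text \<open>
  Call a step \<open>i\<close> an ascent if \<open>X (i + 1) \<ge> t * X i\<close> and a descent if \<open>X (i + 1) \<le> t * X i\<close>.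
  For fixed \<open>n\<close>, let \<open>e m\<close> (\<open>prob_up_down t n m\<close> below) be the probability that, among the steps
  \<open>1, ..., n\<close>, the first \<open>m\<close> are ascents and the remaining ones descents. As the common law has no
  atoms, a step is almost surely not both (\<open>AE_no_tie\<close>), so \<open>e m + e (m + 1)\<close> is the probability
  that steps \<open>1, ..., m\<close> are ascents and steps \<open>m + 2, ..., n\<close> are descents, with no condition on
  step \<open>m + 1\<close>. These two conditions concern the disjoint blocks \<open>X 1, ..., X (m + 1)\<close> and
  \<open>X (m + 2), ..., X (n + 1)\<close> and are therefore independent. Reading a block backwards turns a run of
  descents for \<open>t\<close> into a run of ascents for \<open>1 / t\<close> and does not change the joint law
  (\<open>prob_descents\<close>). Writing \<open>p m t\<close> for \<open>p M X t m\<close>, this gives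
  \<open>e m + e (m + 1) = p m t * p (n - m - 1) (1 / t)\<close> for \<open>m < n\<close> (\<open>prob_turn_step\<close>).

  Since \<open>e n = p n t\<close> and \<open>e 0 = p n (1 / t)\<close>, the alternating sum of these identities is the
  recursion. For the generating functions \<open>P = \<Sum>n. p n t z^n\<close> and \<open>Q = \<Sum>n. p n (1 / t) (-z)^n\<close> the
  recursion says \<open>P = Q + z Q P\<close>, which is the second claim.
\<close>

section \<open>Independent families of random variables\<close>

lemma (in prob_space) indep_vars_reindex_inj:
  assumes ind: "indep_vars N X I" and inj: "inj_on f J" and sub: "f ` J \<subseteq> I"
  shows "indep_vars (\<lambda>j. N (f j)) (\<lambda>j. X (f j)) J"
  unfolding indep_vars_def2
proof (intro conjI ballI indep_setsI)
  fix j assume j: "j \<in> J"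
  then have "f j \<in> I" using sub by auto
  then show rv: "random_variable (N (f j)) (X (f j))"
    using ind by (auto simp: indep_vars_def2)
  show "{X (f j) -` A \<inter> space M |A. A \<in> sets (N (f j))} \<subseteq> events"
    using rv by (auto intro: measurable_sets)
next
  fix A K assume K: "K \<noteq> {}" "K \<subseteq> J" "finite K"
    and A: "\<forall>j\<in>K. A j \<in> {X (f j) -` A \<inter> space M |A. A \<in> sets (N (f j))}"
  have injK: "inj_on f K" using inj K by (auto intro: inj_on_subset)
  define B where "B i = A (the_inv_into K f i)" for i
  have B: "B (f j) = A j" if "j \<in> K" for j
    using that injK by (simp add: B_def the_inv_into_f_f)
  have "indep_sets (\<lambda>i. {X i -` A \<inter> space M |A. A \<in> sets (N i)}) I"
    using ind by (auto simp: indep_vars_def2)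
  then have "prob (\<Inter>i\<in>f ` K. B i) = (\<Prod>i\<in>f ` K. prob (B i))"
    by (rule indep_setsD) (use K sub A B in auto)
  also have "\<dots> = (\<Prod>j\<in>K. prob (A j))"
    using injK B by (simp add: prod.reindex)
  also have "(\<Inter>i\<in>f ` K. B i) = (\<Inter>j\<in>K. A j)" using B by auto
  finally show "prob (\<Inter>j\<in>K. A j) = (\<Prod>j\<in>K. prob (A j))" .
qed

lemma (in prob_space) indep_vars_prob_eq:
  assumes ne: "I \<noteq> {}"
    and Y: "indep_vars N Y I" and Z: "indep_vars N Z I"
    and law: "\<And>i. i \<in> I \<Longrightarrow> distr M (N i) (Y i) = distr M (N i) (Z i)"
    and A: "A \<in> sets (PiM I N)"
  shows "prob {\<omega> \<in> space M. (\<lambda>i\<in>I. Y i \<omega>) \<in> A} = prob {\<omega> \<in> space M. (\<lambda>i\<in>I. Z i \<omega>) \<in> A}"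
proof -
  have rv: "random_variable (N i) (Y i)" "random_variable (N i) (Z i)" if "i \<in> I" for i
    using Y Z that by (auto simp: indep_vars_def2)
  have m: "(\<lambda>\<omega>. \<lambda>i\<in>I. Y i \<omega>) \<in> measurable M (PiM I N)"
    "(\<lambda>\<omega>. \<lambda>i\<in>I. Z i \<omega>) \<in> measurable M (PiM I N)"
    using rv by (auto intro!: measurable_restrict)
  have "distr M (PiM I N) (\<lambda>\<omega>. \<lambda>i\<in>I. Y i \<omega>) = (\<Pi>\<^sub>M i\<in>I. distr M (N i) (Y i))"
    using indep_vars_iff_distr_eq_PiM'[where X=Y and M'=N, OF ne rv(1)] Y by simp
  also have "\<dots> = (\<Pi>\<^sub>M i\<in>I. distr M (N i) (Z i))"
    by (intro PiM_cong law) auto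
  also have "\<dots> = distr M (PiM I N) (\<lambda>\<omega>. \<lambda>i\<in>I. Z i \<omega>)"
    using indep_vars_iff_distr_eq_PiM'[where X=Z and M'=N, OF ne rv(2)] Z by simp
  finally have "measure (distr M (PiM I N) (\<lambda>\<omega>. \<lambda>i\<in>I. Y i \<omega>)) A =
      measure (distr M (PiM I N) (\<lambda>\<omega>. \<lambda>i\<in>I. Z i \<omega>)) A" by simp
  then show ?thesis
    using m A by (simp add: measure_distr vimage_def Int_def conj_commute)
qed

text \<open>By Fubini: for each fixed value \<open>y\<close> of \<open>Y\<close>, the point \<open>t * y\<close> is not an atom of the law of \<open>Z\<close>.\<close>

lemma (in prob_space) indep_var_AE_neq_scaled:
  fixes Y Z :: "'a \<Rightarrow> real"
  assumes ind: "indep_var borel Y borel Z"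
    and cont: "continuous_on UNIV (cdf (distr M borel Z))"
  shows "AE \<omega> in M. Z \<omega> \<noteq> t * Y \<omega>"
proof -
  have rv[measurable]: "random_variable borel Y" "random_variable borel Z"
    using ind by (auto dest: indep_var_rv1 indep_var_rv2)
  interpret Z: real_distribution "distr M borel Z" by (rule real_distribution_distr) fact
  interpret Y: real_distribution "distr M borel Y" by (rule real_distribution_distr) fact
  interpret YZ: pair_sigma_finite "distr M borel Y" "distr M borel Z" ..
  have atom: "emeasure (distr M borel Z) {x} = 0" for x
  proof -
    have "isCont (cdf (distr M borel Z)) x"
      using cont by (simp add: continuous_on_eq_continuous_at)
    then show ?thesis
      using Z.isCont_cdf by (simp add: Z.emeasure_eq_measure)
  qed
  have "AE x in distr M borel Y. AE y in distr M borel Z. y \<noteq> t * x"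
    using atom by (intro AE_I2 AE_I[where N="{t * x}" for x]) auto
  moreover have "{q \<in> space (distr M borel Y \<Otimes>\<^sub>M distr M borel Z). snd q \<noteq> t * fst q}
      \<in> sets (distr M borel Y \<Otimes>\<^sub>M distr M borel Z)"
    by measurable
  ultimately have "AE q in distr M borel Y \<Otimes>\<^sub>M distr M borel Z. snd q \<noteq> t * fst q"
    by (intro YZ.AE_pair_measure) auto
  also have "distr M borel Y \<Otimes>\<^sub>M distr M borel Z = distr M (borel \<Otimes>\<^sub>M borel) (\<lambda>\<omega>. (Y \<omega>, Z \<omega>))"
    using ind indep_var_distribution_eq by blast
  finally show ?thesis by (subst (asm) AE_distr_iff) auto
qed

section \<open>Ascents and descents of an i.i.d. sequence\<close>

text \<open>
  A sequence \<open>X 1, X 2, ...\<close> of i.i.d. real random variables whose law has no atoms. Nothing is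
  assumed about \<open>X 0\<close>, not even measurability.
\<close>

locale continuous_iid = prob_space M for M :: "'a measure" +
  fixes X :: "nat \<Rightarrow> 'a \<Rightarrow> real"
  assumes indep: "indep_vars (\<lambda>_. borel) X {1..}"
    and same_law: "\<And>i. i \<ge> 1 \<Longrightarrow> distr M borel (X i) = distr M borel (X 1)"
    and cont: "continuous_on UNIV (cdf (distr M borel (X 1)))"
begin

text \<open>
  The events that every step \<open>i \<in> S\<close>, leading from \<open>X i\<close> to \<open>X (i + 1)\<close>, is an ascent or a descent
  for the factor \<open>t\<close>. A tie \<open>X (i + 1) = t * X i\<close> counts as both, so the two notions are exchanged
  exactly, not just almost surely, by reversing time and replacing \<open>t > 0\<close> with \<open>1 / t\<close>.
\<close>

definition ascents :: "real \<Rightarrow> nat set \<Rightarrow> 'a set" where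
  "ascents t S = {\<omega> \<in> space M. \<forall>i\<in>S. X (i + 1) \<omega> \<ge> t * X i \<omega>}"

definition descents :: "real \<Rightarrow> nat set \<Rightarrow> 'a set" where
  "descents t S = {\<omega> \<in> space M. \<forall>i\<in>S. X (i + 1) \<omega> \<le> t * X i \<omega>}"

lemma rv [measurable]: "i \<ge> 1 \<Longrightarrow> random_variable borel (X i)"
  using indep by (auto simp: indep_vars_def2)

lemma ascents_events:
  assumes "S \<subseteq> {1..}"
  shows "ascents t S \<in> events"
proof -
  have *: "{\<omega> \<in> space M. X (i + 1) \<omega> \<ge> t * X i \<omega>} \<in> events" if "i \<in> S" for i
  proof -
    have "i \<ge> 1" using that assms by auto
    then show ?thesis by measurable
  qed
  show ?thesis unfolding ascents_def by (intro sets.sets_Collect_countable_All' *) auto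
qed

lemma descents_events:
  assumes "S \<subseteq> {1..}"
  shows "descents t S \<in> events"
proof -
  have *: "{\<omega> \<in> space M. X (i + 1) \<omega> \<le> t * X i \<omega>} \<in> events" if "i \<in> S" for i
  proof -
    have "i \<ge> 1" using that assms by auto
    then show ?thesis by measurable
  qed
  show ?thesis unfolding descents_def by (intro sets.sets_Collect_countable_All' *) auto
qed

lemma p_eq_prob_ascents: "p M X t n = prob (ascents t {1..n})"
  by (simp add: p_def ascents_def prob_space)

lemma AE_no_tie:
  assumes "i \<ge> 1"
  shows "AE \<omega> in M. X (i + 1) \<omega> \<noteq> t * X i \<omega>"
proof (rule indep_var_AE_neq_scaled)
  have "indep_var borel ((\<lambda>f. f i) \<circ> (\<lambda>\<omega>. \<lambda>j\<in>{i}. X j \<omega>)) borel ((\<lambda>f. f (i + 1)) \<circ> (\<lambda>\<omega>. \<lambda>j\<in>{i + 1}. X j \<omega>))"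
    using assms by (intro indep_var_compose[OF indep_var_restrict[OF indep]]) auto
  then show "indep_var borel (X i) borel (X (i + 1))" by (simp add: comp_def)
  show "continuous_on UNIV (cdf (distr M borel (X (i + 1))))"
    using cont same_law[of "i + 1"] by simp
qed

text \<open>The block \<open>X l, ..., X (l + k)\<close>, read backwards, has the law of \<open>X 1, ..., X (k + 1)\<close>.\<close>

lemma prob_descents:
  assumes l: "l \<ge> 1" and t: "t > 0"
  shows "prob (descents t {l..<l + k}) = p M X (1 / t) k"
proof -
  define I where "I = {1..k + 1}"
  define Z where "Z i = X (l + k + 1 - i)" for i
  define A where "A = {x \<in> space (Pi\<^sub>M I (\<lambda>_. borel :: real measure)). \<forall>i\<in>{1..k}. x (i + 1) \<ge> 1 / t * x i}"
  have A: "A \<in> sets (Pi\<^sub>M I (\<lambda>_. borel))"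
    unfolding A_def by (intro sets.sets_Collect_countable_All') (auto simp: I_def)
  have Y: "indep_vars (\<lambda>_. borel) X I"
    using indep by (rule indep_vars_subset) (auto simp: I_def)
  have Z: "indep_vars (\<lambda>_. borel) Z I"
    unfolding Z_def
    by (rule indep_vars_reindex_inj[OF indep]) (use l in \<open>auto simp: I_def inj_on_def\<close>)
  have law: "distr M borel (Z i) = distr M borel (X i)" if "i \<in> I" for i
    using that l same_law[of i] same_law[of "l + k + 1 - i"] by (auto simp: I_def Z_def)
  have "descents t {l..<l + k} = {\<omega> \<in> space M. \<forall>i\<in>{1..k}. Z (i + 1) \<omega> \<ge> 1 / t * Z i \<omega>}"
  proof -
    have "(\<forall>j\<in>{l..<l + k}. X (j + 1) \<omega> \<le> t * X j \<omega>) \<longleftrightarrow>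
        (\<forall>i\<in>{1..k}. X (l + k - i + 1) \<omega> \<le> t * X (l + k - i) \<omega>)" for \<omega>
    proof -
      have "{l..<l + k} = (\<lambda>i. l + k - i) ` {1..k}"
      proof (intro equalityI subsetI)
        fix j assume "j \<in> {l..<l + k}"
        then show "j \<in> (\<lambda>i. l + k - i) ` {1..k}" by (intro image_eqI[of _ _ "l + k - j"]) auto
      qed auto
      then show ?thesis by simp
    qed
    moreover have "X (l + k - i + 1) \<omega> \<le> t * X (l + k - i) \<omega> \<longleftrightarrow> Z (i + 1) \<omega> \<ge> 1 / t * Z i \<omega>"
      if "i \<in> {1..k}" for i \<omega>
      using that t by (simp add: Z_def Suc_diff_le field_simps)
    ultimately show ?thesis unfolding descents_def by auto
  qed
  also have "\<dots> = {\<omega> \<in> space M. (\<lambda>i\<in>I. Z i \<omega>) \<in> A}"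
    by (auto simp: A_def I_def space_PiM)
  also have "prob \<dots> = prob {\<omega> \<in> space M. (\<lambda>i\<in>I. X i \<omega>) \<in> A}"
    by (rule indep_vars_prob_eq[OF _ Z Y law A]) (auto simp: I_def)
  also have "{\<omega> \<in> space M. (\<lambda>i\<in>I. X i \<omega>) \<in> A} = ascents (1 / t) {1..k}"
    by (auto simp: A_def I_def space_PiM ascents_def)
  finally show ?thesis by (simp only: p_eq_prob_ascents)
qed

text \<open>Step \<open>m + 1\<close> is unconstrained, so the two events depend on disjoint blocks of variables.\<close>

lemma prob_ascents_Int_descents:
  "prob (ascents t {1..m} \<inter> descents t {m + 2..<m + 2 + k}) =
    prob (ascents t {1..m}) * prob (descents t {m + 2..<m + 2 + k})"
proof -
  define I where "I = {1..m + 1}"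
  define J where "J = {m + 2..m + 2 + k}"
  define A where "A = {x \<in> space (Pi\<^sub>M I (\<lambda>_. borel :: real measure)). \<forall>i\<in>{1..m}. x (i + 1) \<ge> t * x i}"
  define B where "B = {x \<in> space (Pi\<^sub>M J (\<lambda>_. borel :: real measure)). \<forall>i\<in>{m + 2..<m + 2 + k}. x (i + 1) \<le> t * x i}"
  have A: "A \<in> sets (Pi\<^sub>M I (\<lambda>_. borel))"
    unfolding A_def by (intro sets.sets_Collect_countable_All') (auto simp: I_def)
  have B: "B \<in> sets (Pi\<^sub>M J (\<lambda>_. borel))"
    unfolding B_def by (intro sets.sets_Collect_countable_All') (auto simp: J_def)
  have ind: "indep_var (Pi\<^sub>M I (\<lambda>_. borel)) (\<lambda>\<omega>. \<lambda>i\<in>I. X i \<omega>) (Pi\<^sub>M J (\<lambda>_. borel)) (\<lambda>\<omega>. \<lambda>i\<in>J. X i \<omega>)"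
    by (rule indep_var_restrict[OF indep]) (auto simp: I_def J_def)
  have "(\<lambda>\<omega>. \<lambda>i\<in>I. X i \<omega>) -` A \<inter> space M = ascents t {1..m}"
    by (auto simp: A_def I_def space_PiM ascents_def)
  moreover have "(\<lambda>\<omega>. \<lambda>i\<in>J. X i \<omega>) -` B \<inter> space M = descents t {m + 2..<m + 2 + k}"
    by (auto simp: B_def J_def space_PiM descents_def)
  moreover have "(\<lambda>\<omega>. (\<lambda>i\<in>I. X i \<omega>, \<lambda>i\<in>J. X i \<omega>)) -` (A \<times> B) \<inter> space M =
      ((\<lambda>\<omega>. \<lambda>i\<in>I. X i \<omega>) -` A \<inter> space M) \<inter> ((\<lambda>\<omega>. \<lambda>i\<in>J. X i \<omega>) -` B \<inter> space M)"
    by auto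
  ultimately show ?thesis using indep_varD[OF ind A B] by simp
qed

text \<open>
  The probability that, among the steps \<open>1, ..., n\<close>, the first \<open>m\<close> are ascents and the remaining
  ones descents; it is meant for \<open>m \<le> n\<close>.
\<close>

definition prob_up_down :: "real \<Rightarrow> nat \<Rightarrow> nat \<Rightarrow> real" where
  "prob_up_down t n m = prob (ascents t {1..m} \<inter> descents t {m + 1..<n + 1})"

lemma prob_turn_step:
  assumes t: "t > 0" and m: "m < n"
  shows "prob_up_down t n m + prob_up_down t n (m + 1) = p M X t m * p M X (1 / t) (n - m - 1)"
proof -
  define k where "k = n - m - 1"
  have n: "n + 1 = m + 2 + k" using m by (simp add: k_def)
  let ?D = "descents t {m + 2..<m + 2 + k}"
  let ?E = "ascents t {1..m} \<inter> descents t {m + 1..<n + 1}"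
  let ?E' = "ascents t {1..m + 1} \<inter> descents t {m + 2..<n + 1}"
  have up: "{1..m + 1} = insert (m + 1) {1..m}" by auto
  have down: "{m + 1..<n + 1} = insert (m + 1) {m + 2..<m + 2 + k}" using n by auto
  have "AE \<omega> in M. X (m + 1 + 1) \<omega> \<noteq> t * X (m + 1) \<omega>" by (rule AE_no_tie) simp
  then have "AE \<omega> in M. \<omega> \<notin> ?E \<or> \<omega> \<notin> ?E'"
  proof (rule AE_mp, intro AE_I2 impI)
    fix \<omega> assume "X (m + 1 + 1) \<omega> \<noteq> t * X (m + 1) \<omega>"
    then have "\<not> X (m + 1 + 1) \<omega> \<le> t * X (m + 1) \<omega> \<or> \<not> t * X (m + 1) \<omega> \<le> X (m + 1 + 1) \<omega>" by simp
    moreover have "m + 1 \<in> {m + 1..<n + 1}" "m + 1 \<in> {1..m + 1}" using m by auto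
    ultimately show "\<omega> \<notin> ?E \<or> \<omega> \<notin> ?E'"
      unfolding ascents_def descents_def by blast
  qed
  then have "prob (?E \<union> ?E') = prob ?E + prob ?E'"
    by (rule measure_Un_AE)
      (auto simp: fmeasurable_eq_sets intro!: sets.Int ascents_events descents_events)
  moreover have "?E \<union> ?E' = ascents t {1..m} \<inter> ?D"
    unfolding n[symmetric] up down by (auto simp: ascents_def descents_def n)
  ultimately have "prob ?E + prob ?E' = prob (ascents t {1..m} \<inter> ?D)" by simp
  also have "\<dots> = p M X t m * p M X (1 / t) k"
    using prob_ascents_Int_descents prob_descents[OF _ t, of "m + 2" k] by (simp add: p_eq_prob_ascents)
  finally show ?thesis by (simp add: prob_up_down_def k_def)
qed

lemma p_recursion:
  assumes t: "t > 0"
  shows "p M X t n = (\<Sum>k=1..n. p M X t (n - k) * p M X (1 / t) (k - 1) * (-1) ^ (k - 1))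
    + (-1) ^ n * p M X (1 / t) n"
proof -
  \<comment> \<open>Unfolding \<open>prob_turn_step\<close> \<open>j\<close> times, moving the turning point back from step \<open>n\<close> to \<open>n - j\<close>.\<close>
  have "prob_up_down t n n = (\<Sum>k=1..j. p M X t (n - k) * p M X (1 / t) (k - 1) * (-1) ^ (k - 1))
      + (-1) ^ j * prob_up_down t n (n - j)" if "j \<le> n" for j
    using that
  proof (induction j)
    case (Suc j)
    have "n - Suc j + 1 = n - j" "n - (n - Suc j) - 1 = j" using Suc.prems by auto
    then have "prob_up_down t n (n - j) = p M X t (n - Suc j) * p M X (1 / t) j - prob_up_down t n (n - Suc j)"
      using prob_turn_step[OF t, of "n - Suc j" n] Suc.prems by simp
    then have "(-1) ^ j * prob_up_down t n (n - j) =
        p M X t (n - Suc j) * p M X (1 / t) j * (-1) ^ j + (-1) ^ Suc j * prob_up_down t n (n - Suc j)"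
      by (simp add: right_diff_distrib mult_ac)
    then show ?case using Suc by simp
  qed simp
  from this[of n] have "prob_up_down t n n = (\<Sum>k=1..n. p M X t (n - k) * p M X (1 / t) (k - 1) * (-1) ^ (k - 1))
      + (-1) ^ n * prob_up_down t n 0" by simp
  moreover have "prob_up_down t n n = p M X t n"
    unfolding prob_up_down_def p_eq_prob_ascents by (rule arg_cong[of _ _ prob]) (auto simp: ascents_def descents_def)
  moreover have "prob_up_down t n 0 = p M X (1 / t) n"
  proof -
    have "ascents t {1..0} \<inter> descents t {0 + 1..<n + 1} = descents t {1..<1 + n}"
      by (auto simp: ascents_def descents_def)
    then show ?thesis unfolding prob_up_down_def using prob_descents[OF _ t, of 1 n] by simp
  qed
  ultimately show ?thesis by simp
qed

end

section \<open>The generating function\<close>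

lemma Abs_fps_eq_divide_of_recursion:
  fixes a b :: "nat \<Rightarrow> 'a::field"
  assumes rec: "\<And>n. a n = (\<Sum>k=1..n. a (n - k) * b (k - 1) * (-1) ^ (k - 1)) + (-1) ^ n * b n"
  shows "Abs_fps a = (Abs_fps b oo (- fps_X)) / (1 - fps_X * (Abs_fps b oo (- fps_X)))"
proof -
  let ?Q = "Abs_fps b oo (- fps_X)"
  have Q: "fps_nth ?Q n = (-1) ^ n * b n" for n
    by (simp add: fps_compose_uminus')
  have "Abs_fps a = ?Q + fps_X * (?Q * Abs_fps a)"
  proof (rule fps_ext)
    fix n
    show "fps_nth (Abs_fps a) n = fps_nth (?Q + fps_X * (?Q * Abs_fps a)) n"
    proof (cases n)
      case 0
      then show ?thesis using rec[of 0] by (simp add: Q)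
    next
      case (Suc m)
      have "(\<Sum>k=1..n. a (n - k) * b (k - 1) * (-1) ^ (k - 1)) =
          (\<Sum>i=0..m. fps_nth ?Q i * a (m - i))"
        using Suc by (simp only: One_nat_def sum.shift_bounds_cl_Suc_ivl) (simp add: Q mult_ac)
      also have "\<dots> = fps_nth (?Q * Abs_fps a) m"
        by (simp add: fps_mult_nth)
      also have "\<dots> = fps_nth (fps_X * (?Q * Abs_fps a)) n"
        using Suc by simp
      finally show ?thesis using rec[of n] by (simp add: Q)
    qed
  qed
  then have "Abs_fps a * (1 - fps_X * ?Q) = ?Q"
    by (simp add: algebra_simps)
  moreover have "1 - fps_X * ?Q \<noteq> 0"
  proof
    assume "1 - fps_X * ?Q = 0"
    then have "fps_nth (1 - fps_X * ?Q) 0 = fps_nth 0 0" by metis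
    then show False by simp
  qed
  ultimately show ?thesis using nonzero_mult_div_cancel_right[of "1 - fps_X * ?Q" "Abs_fps a"] by simp
qed

theorem lemma2:
  fixes M :: "'a measure" and X :: "nat \<Rightarrow> 'a \<Rightarrow> real" and \<theta> :: real
  assumes "prob_space M"
    and "prob_space.indep_vars M (\<lambda>_. borel) X {1..}"
    and "\<forall>i\<ge>1. distr M borel (X i) = distr M borel (X 1)"
    and "continuous_on UNIV (cdf (distr M borel (X 1)))"
    and "\<theta> > 0"
  shows "(\<forall>n. p M X \<theta> n =
            (\<Sum>k=1..n. p M X \<theta> (n - k) * p M X (1/\<theta>) (k - 1) * (-1) ^ (k - 1))
              + (-1) ^ n * p M X (1/\<theta>) n)
       \<and> P_hat M X \<theta> =
           (P_hat M X (1/\<theta>) oo (- fps_X)) / (1 - fps_X * (P_hat M X (1/\<theta>) oo (- fps_X)))"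
proof -
  interpret prob_space M by fact
  interpret continuous_iid M X
    by unfold_locales (use assms in blast)+
  show ?thesis
    unfolding P_hat_def
    by (intro conjI allI Abs_fps_eq_divide_of_recursion p_recursion[OF \<open>\<theta> > 0\<close>])
qed

end
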